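(* Let $0<\mu\le L$ and $f\in\mathcal S^1_{\mu,L}$. Let $s>0$, $q=\mu s$, and let $\eta,\nu,\tau$ be real numbers such that $0\le\eta s\le1/L$, $\nu\ge0$, $1-\nu\sqrt q>0$, $\tau>0$ and $\zeta:=1+(1-\tau)\sqrt q\ge0$. Then the iterates of algorithm $(\mathcal A)$ (defined in the context) satisfy, for every $k\ge1$, $$\Big(\frac{\zeta\nu}{\tau^2}(\tau+\zeta\eta\sqrt q)+\frac{\nu\sqrt q}{1-\nu\sqrt q}\Big)(f(x_k)-f^* )-\frac{\nu s}{2}\Big(\frac{\nu}{1-\nu\sqrt q}-\frac{\zeta\eta}{\tau}\Big)\|\nabla f(x_k)\|^2+\frac{1}{1-\nu\sqrt q}\,\frac\mu2\|z_{k+1}-x^*\|^2$$ $$\le\frac{\zeta\nu}{\tau^2}(\tau+\zeta\eta\sqrt q)\Big(f(x_{k-1})-f^*-\frac{\eta s}{2}\|\nabla f(x_{k-1})\|^2\Big)+\frac\mu2\|z_k-x^*\|^2.$$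
   Context: For $0<\mu\le L$, $\mathcal S^1_{\mu,L}$ is the set of continuously differentiable convex functions $f:\mathbb R^n\to\mathbb R$ that are $L$-smooth ($\|\nabla f(y)-\nabla f(x)\|\le L\|y-x\|$ for all $x,y$) and $\mu$-strongly convex ($f(y)\ge f(x)+\langle\nabla f(x),y-x\rangle+\frac{\mu}{2}\|y-x\|^2$ for all $x,y$); $\|\cdot\|$ is the Euclidean norm. $x^*$ is the unique minimizer of $f$ and $f^*=f(x^* )$. Algorithm $(\mathcal A)$ with parameters $\eta,\nu,\tau\ge0$: starting from $x_0=z_0\in\mathbb R^n$, for $k\ge0$, $$y_{k+1}=x_k-\eta s\nabla f(x_k),$$ $$z_{k+1}=\nu\sqrt q\,\Big(x_k-\frac1\mu\nabla f(x_k)\Big)+(1-\nu\sqrt q)z_k,$$ $$x_{k+1}=\frac{\tau\sqrt q}{1+\sqrt q}z_{k+1}+\Big(1-\frac{\tau\sqrt q}{1+\sqrt q}\Big)y_{k+1}.$$ *)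

theory Defs
  imports "HOL-Analysis.Analysis"
begin

definition grad :: "(real ^ 'n \<Rightarrow> real) \<Rightarrow> real ^ 'n \<Rightarrow> real ^ 'n" where
  "grad f x = (THE D. GDERIV f x :> D)"

lemma grad_eqI:
  assumes "GDERIV f x :> D"
  shows "grad f x = D"
  unfolding grad_def
proof (rule the_equality)
  fix D' assume "GDERIV f x :> D'"
  with assms have "(\<lambda>h. inner h D') = (\<lambda>h. inner h D)"
    unfolding gderiv_def by (rule has_derivative_unique[rotated])
  then have "inner h D' = inner h D" for h by metis
  then show "D' = D" by (metis inner_commute vector_eq_ldot)
qed (fact assms)

lemma GDERIV_grad:
  assumes "f differentiable (at x)"
  shows "GDERIV f x :> grad f x"
proof -
  from assms obtain f' where f': "(f has_derivative f') (at x)"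
    by (auto simp: differentiable_def)
  then interpret bounded_linear f' by (rule has_derivative_bounded_linear)
  have "f' = (\<lambda>h. inner h (adjoint f' 1))"
    using adjoint_works[OF linear_axioms, of _ 1] by auto
  with f' have "GDERIV f x :> adjoint f' 1" by (simp add: gderiv_def)
  with grad_eqI show ?thesis by metis
qed

definition smooth_strongly_convex :: "real \<Rightarrow> real \<Rightarrow> (real ^ 'n \<Rightarrow> real) set" where
  "smooth_strongly_convex \<mu> L = {f.
     (\<forall>x. f differentiable (at x)) \<and> continuous_on UNIV (grad f) \<and> convex_on UNIV f \<and>
     (\<forall>x y. norm (grad f y - grad f x) \<le> L * norm (y - x)) \<and>
     (\<forall>x y. f y \<ge> f x + grad f x \<bullet> (y - x) + \<mu> / 2 * (norm (y - x))\<^sup>2)}"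

definition minimizer :: "(real ^ 'n \<Rightarrow> real) \<Rightarrow> real ^ 'n" where
  "minimizer f = (THE x. \<forall>y. f x \<le> f y)"

lemma ex1_minimizer:
  fixes f :: "real ^ 'n \<Rightarrow> real"
  assumes mu: "\<mu> > 0" and f: "f \<in> smooth_strongly_convex \<mu> L"
  shows "\<exists>!x. \<forall>y. f x \<le> f y"
proof -
  have d: "f differentiable (at x)" for x
    using f by (auto simp: smooth_strongly_convex_def)
  have sc: "f y \<ge> f x + grad f x \<bullet> (y - x) + \<mu> / 2 * (norm (y - x))\<^sup>2" for x y
    using f by (auto simp: smooth_strongly_convex_def)
  have cont: "continuous_on S f" for S
    using d by (meson continuous_at_imp_continuous_on differentiable_imp_continuous_within)
  define R where "R = 2 * norm (grad f 0) / \<mu>"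
  have R: "R \<ge> 0" using mu by (simp add: R_def)
  then have "cball (0 :: real ^ 'n) R \<noteq> {}" by simp
  then obtain x where x: "\<And>y. y \<in> cball 0 R \<Longrightarrow> f x \<le> f y"
    using continuous_attains_inf[OF compact_cball _ cont, of 0 R] by blast
  have out: "f 0 \<le> f y" if "y \<notin> cball 0 R" for y
  proof -
    have "2 * norm (grad f 0) \<le> \<mu> * norm y"
      using that mu by (simp add: R_def field_simps)
    then have "norm (grad f 0) * norm y \<le> \<mu> / 2 * (norm y)\<^sup>2"
      using mult_right_mono[of "2 * norm (grad f 0)" "\<mu> * norm y" "norm y"]
      by (simp add: power2_eq_square)
    moreover have "\<bar>grad f 0 \<bullet> y\<bar> \<le> norm (grad f 0) * norm y"
      by (rule Cauchy_Schwarz_ineq2)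
    ultimately show ?thesis using sc[of 0 y] by simp
  qed
  have min: "\<forall>y. f x \<le> f y"
    using x out R by (metis centre_in_cball order_trans)
  moreover have "a = b" if a: "\<forall>y. f a \<le> f y" and b: "\<forall>y. f b \<le> f y" for a b
  proof -
    have "((\<lambda>h. h \<bullet> grad f a)) = (\<lambda>h. 0)"
      using GDERIV_grad[OF d, of a] a unfolding gderiv_def
      by (intro has_derivative_local_min[of f]) auto
    then have "(b - a) \<bullet> grad f a = 0" by metis
    then have "\<mu> / 2 * (norm (b - a))\<^sup>2 \<le> 0"
      using sc[of a b] b[rule_format, of a] by (simp add: inner_commute)
    with mu show ?thesis by (simp add: mult_le_0_iff)
  qed
  ultimately show ?thesis by blast
qed

definition is_run ::
  "(real ^ 'n \<Rightarrow> real) \<Rightarrow> real \<Rightarrow> real \<Rightarrow> real \<Rightarrow> real \<Rightarrow> real \<Rightarrow>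
   (nat \<Rightarrow> real ^ 'n) \<Rightarrow> (nat \<Rightarrow> real ^ 'n) \<Rightarrow> (nat \<Rightarrow> real ^ 'n) \<Rightarrow> bool" where
  "is_run f \<mu> s \<eta> \<nu> \<tau> x y z \<longleftrightarrow> (let q = \<mu> * s in
     x 0 = z 0 \<and>
     (\<forall>k. y (Suc k) = x k - (\<eta> * s) *\<^sub>R grad f (x k) \<and>
          z (Suc k) = (\<nu> * sqrt q) *\<^sub>R (x k - (1 / \<mu>) *\<^sub>R grad f (x k))
                      + (1 - \<nu> * sqrt q) *\<^sub>R z k \<and>
          x (Suc k) = (\<tau> * sqrt q / (1 + sqrt q)) *\<^sub>R z (Suc k)
                      + (1 - \<tau> * sqrt q / (1 + sqrt q)) *\<^sub>R y (Suc k)))"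

end

theory Submission imports Defs begin

text \<open>
  Completing the square in the update of \<open>z\<close> and using strong convexity at \<open>x k\<close> against the
  minimizer cancels the terms with denominator \<open>1 - \<nu> * sqrt q\<close>. What remains only involves
  \<open>x k - z k\<close>, which is \<open>\<zeta> / (\<tau> * sqrt q)\<close> times \<open>y k - x k\<close>. It splits into two multiples of the
  cocoercivity inequality between \<open>x k\<close> and \<open>x (k - 1)\<close>: with weight \<open>\<zeta> * \<nu> / \<tau>\<close> it absorbs the
  inner product with the gradient, and with weight \<open>\<zeta>\<^sup>2 * \<nu> * \<eta> * sqrt q / \<tau>\<^sup>2\<close>, combined with Young's
  inequality, it is absorbed by the squared distance \<open>x k - z k\<close>.
\<close>

text \<open>On the ray from \<open>u\<close> through \<open>v\<close>, \<open>\<phi>\<close> is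
  \<open>f\<close> minus its claimed quadratic upper bound, up to a constant. By Cauchy-Schwarz and
  the Lipschitz gradient its slope is nonpositive for \<open>t \<ge> 0\<close>, so
  \<open>\<phi> 1 \<le> \<phi> 0\<close>.\<close>

lemma descent_inequality:
  fixes f :: "real ^ 'n \<Rightarrow> real"
  assumes d: "\<And>x. f differentiable (at x)"
    and lip: "\<And>x y. norm (grad f y - grad f x) \<le> L * norm (y - x)"
  shows "f v \<le> f u + grad f u \<bullet> (v - u) + L / 2 * (norm (v - u))\<^sup>2"
proof -
  define e where "e = v - u"
  define \<phi> where "\<phi> t = f (u + t *\<^sub>R e) - t * (grad f u \<bullet> e) - L / 2 * t\<^sup>2 * (norm e)\<^sup>2" for t
  define \<phi>' where "\<phi>' t = grad f (u + t *\<^sub>R e) \<bullet> e - grad f u \<bullet> e - L * t * (norm e)\<^sup>2" for t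
  have "((\<lambda>t. f (u + t *\<^sub>R e)) has_derivative (\<lambda>h. (h *\<^sub>R e) \<bullet> grad f (u + t *\<^sub>R e))) (at t)" for t
  proof (rule has_derivative_compose[of "\<lambda>t. u + t *\<^sub>R e" "\<lambda>h. h *\<^sub>R e"])
    show "((\<lambda>t. u + t *\<^sub>R e) has_derivative (\<lambda>h. h *\<^sub>R e)) (at t)"
      by (auto intro!: derivative_eq_intros)
    show "(f has_derivative (\<lambda>h. h \<bullet> grad f (u + t *\<^sub>R e))) (at (u + t *\<^sub>R e))"
      using GDERIV_grad[OF d] by (simp add: gderiv_def)
  qed
  then have "((\<lambda>t. f (u + t *\<^sub>R e)) has_real_derivative grad f (u + t *\<^sub>R e) \<bullet> e) (at t)" for t
    by (simp add: has_field_derivative_def inner_commute mult_commute_abs)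
  then have der: "(\<phi> has_real_derivative \<phi>' t) (at t)" for t
    unfolding \<phi>_def \<phi>'_def by (auto intro!: derivative_eq_intros)
  have nonpos: "\<phi>' t \<le> 0" if "0 \<le> t" for t
  proof -
    have "grad f (u + t *\<^sub>R e) \<bullet> e - grad f u \<bullet> e \<le> norm (grad f (u + t *\<^sub>R e) - grad f u) * norm e"
      by (metis inner_diff_left norm_cauchy_schwarz)
    also have "\<dots> \<le> L * norm (t *\<^sub>R e) * norm e"
      using lip[of "u + t *\<^sub>R e" u] by (intro mult_right_mono) auto
    finally show ?thesis
      using that by (simp add: \<phi>'_def power2_eq_square)
  qed
  have "\<phi> 1 \<le> \<phi> 0"
    by (rule DERIV_nonpos_imp_nonincreasing) (use der nonpos in \<open>simp, blast\<close>)
  then show ?thesis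
    by (simp add: \<phi>_def e_def)
qed

lemma cocoercivity:
  fixes f :: "real ^ 'n \<Rightarrow> real"
  assumes L: "L > 0"
    and d: "\<And>x. f differentiable (at x)"
    and lip: "\<And>x y. norm (grad f y - grad f x) \<le> L * norm (y - x)"
    and cvx: "\<And>x y. f y \<ge> f x + grad f x \<bullet> (y - x)"
  shows "f v \<ge> f u + grad f u \<bullet> (v - u) + 1 / (2 * L) * (norm (grad f u - grad f v))\<^sup>2"
proof -
  define e where "e = grad f v - grad f u"
  \<comment> \<open>A gradient step from \<open>v\<close> for the convex function \<open>\<lambda>x. f x - grad f u \<bullet> x\<close>, which is minimal
    at \<open>u\<close>.\<close>
  define w where "w = v - (1 / L) *\<^sub>R e"
  \<comment> \<open>Convexity at \<open>u\<close> bounds \<open>f w\<close> from below, the descent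
    inequality at \<open>v\<close> from above. The gap leaves \<open>1 / L - 1 / (2 * L)\<close>
    times the squared norm of \<open>e\<close>.\<close>
  have "f u + grad f u \<bullet> (v - u) - 1 / L * (grad f u \<bullet> e) \<le> f w"
    using cvx[of u w] by (simp add: w_def inner_diff_right)
  also have "f w \<le> f v - 1 / L * (grad f v \<bullet> e) + L / 2 * (norm ((1 / L) *\<^sub>R e))\<^sup>2"
    using descent_inequality[OF d lip, of w v] by (simp add: w_def)
  also have "L / 2 * (norm ((1 / L) *\<^sub>R e))\<^sup>2 = 1 / (2 * L) * (norm e)\<^sup>2"
    using L by (simp add: power_mult_distrib power2_eq_square)
  finally have "f u + grad f u \<bullet> (v - u) + 1 / L * (e \<bullet> e) \<le> f v + 1 / (2 * L) * (norm e)\<^sup>2"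
    by (simp add: e_def inner_diff_left diff_divide_distrib)
  then show ?thesis
    using norm_minus_commute[of "grad f u" "grad f v"] by (simp add: e_def power2_norm_eq_inner)
qed

text \<open>An identity rather than the convexity bound: the subtracted term is what later yields
  the squared distance between \<open>x k\<close> and \<open>z k\<close>.\<close>

lemma norm_convex_comb_sq:
  fixes u v :: "'a::real_inner"
  shows "(norm (a *\<^sub>R u + (1 - a) *\<^sub>R v))\<^sup>2
    = a * (norm u)\<^sup>2 + (1 - a) * (norm v)\<^sup>2 - a * (1 - a) * (norm (u - v))\<^sup>2"
  unfolding power2_norm_eq_inner
  by (simp add: inner_simps inner_commute[of v u]) (simp add: algebra_simps)

lemma norm_diff_sq:
  fixes u v :: "'a::real_inner"
  shows "(norm (u - v))\<^sup>2 = (norm u)\<^sup>2 - 2 * (u \<bullet> v) + (norm v)\<^sup>2"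
  unfolding power2_norm_eq_inner by (simp add: inner_simps inner_commute)

theorem lemma2:
  fixes f :: "real ^ 'n \<Rightarrow> real"
    and \<mu> L s q \<eta> \<nu> \<tau> \<zeta> fstar :: real
    and x y z :: "nat \<Rightarrow> real ^ 'n"
    and xstar :: "real ^ 'n"
    and k :: nat
  assumes "0 < \<mu>" and "\<mu> \<le> L"
    and "f \<in> smooth_strongly_convex \<mu> L"
    and "s > 0" and "q = \<mu> * s"
    and "0 \<le> \<eta> * s" and "\<eta> * s \<le> 1 / L"
    and "\<nu> \<ge> 0" and "1 - \<nu> * sqrt q > 0"
    and "\<tau> > 0"
    and "\<zeta> = 1 + (1 - \<tau>) * sqrt q" and "\<zeta> \<ge> 0"
    and "xstar = minimizer f" and "fstar = f xstar"
    and "is_run f \<mu> s \<eta> \<nu> \<tau> x y z"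
    and "k \<ge> 1"
  shows "(\<zeta> * \<nu> / \<tau>\<^sup>2 * (\<tau> + \<zeta> * \<eta> * sqrt q) + \<nu> * sqrt q / (1 - \<nu> * sqrt q)) * (f (x k) - fstar)
          - \<nu> * s / 2 * (\<nu> / (1 - \<nu> * sqrt q) - \<zeta> * \<eta> / \<tau>) * (norm (grad f (x k)))\<^sup>2
          + 1 / (1 - \<nu> * sqrt q) * (\<mu> / 2) * (norm (z (k + 1) - xstar))\<^sup>2
        \<le> \<zeta> * \<nu> / \<tau>\<^sup>2 * (\<tau> + \<zeta> * \<eta> * sqrt q) *
            (f (x (k - 1)) - fstar - \<eta> * s / 2 * (norm (grad f (x (k - 1))))\<^sup>2)
          + \<mu> / 2 * (norm (z k - xstar))\<^sup>2"
proof -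
  have f: "f differentiable (at u)"
    "norm (grad f v - grad f u) \<le> L * norm (v - u)"
    "f v \<ge> f u + grad f u \<bullet> (v - u) + \<mu> / 2 * (norm (v - u))\<^sup>2" for u v
    using assms(3) by (auto simp: smooth_strongly_convex_def)
  have cvx: "f v \<ge> f u + grad f u \<bullet> (v - u)" for u v
  proof -
    have "0 \<le> \<mu> / 2 * (norm (v - u))\<^sup>2" using \<open>0 < \<mu>\<close> by simp
    with f(3)[of u v] show ?thesis by linarith
  qed
  have L: "L > 0" using assms by simp
  \<comment> \<open>The run constrains \<open>y\<close> only from index 1 on, so
    \<open>k \<ge> 1\<close> is what ties \<open>y k\<close> to a gradient step from
    \<open>x j\<close>.\<close>
  obtain j where k: "k = Suc j" using \<open>k \<ge> 1\<close> by (cases k) auto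
  define r where "r = sqrt q"
  have r: "r > 0" and r2: "r\<^sup>2 = \<mu> * s"
    using assms by (auto simp: r_def)
  define a where "a = \<nu> * r"
  have a: "0 \<le> a" "0 < 1 - a"
    using assms r by (auto simp: a_def r_def)
  define b where "b = \<eta> * s"
  have b: "0 \<le> b" "b \<le> 1 / L" using assms by (auto simp: b_def)
  define g h where "g = grad f (x k)" and "h = grad f (x j)"
  define X Z p where "X = x k - xstar" and "Z = z k - xstar" and "p = y k - x k"
  have yk: "y k = x j - b *\<^sub>R h"
    and zk: "z (k + 1) = a *\<^sub>R (x k - (1 / \<mu>) *\<^sub>R g) + (1 - a) *\<^sub>R z k"
    and xk: "x k = (\<tau> * r / (1 + r)) *\<^sub>R z k + (1 - \<tau> * r / (1 + r)) *\<^sub>R y k"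
    using assms(15)
    by (auto simp: is_run_def Let_def k g_def h_def a_def b_def r_def \<open>q = \<mu> * s\<close>)
  \<comment> \<open>With \<open>t = \<tau> * r / (1 + r)\<close> the update of \<open>x\<close> says
    that \<open>t\<close> times \<open>x k - z k\<close> is \<open>1 - t\<close> times
    \<open>p\<close>; multiplying by \<open>1 + r\<close> turns \<open>1 - t\<close> into
    \<open>\<zeta>\<close>.\<close>
  have xz: "(\<tau> * r) *\<^sub>R (x k - z k) = \<zeta> *\<^sub>R p"
  proof -
    have "\<zeta> = (1 + r) * (1 - \<tau> * r / (1 + r))"
      using r by (simp add: assms(11) r_def[symmetric] field_simps)
    moreover have "\<tau> * r = (1 + r) * (\<tau> * r / (1 + r))"
      using r by simp
    moreover have "t *\<^sub>R (x k - z k) = (1 - t) *\<^sub>R (y k - x k)"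
      if "x k = t *\<^sub>R z k + (1 - t) *\<^sub>R y k" for t
      using that by (simp add: algebra_simps)
    ultimately show ?thesis
      using xk by (metis p_def scaleR_scaleR)
  qed
  then have xz': "x k - z k = (\<zeta> / (\<tau> * r)) *\<^sub>R p"
    using r \<open>\<tau> > 0\<close>
    by (metis divide_inverse_commute less_irrefl mult_pos_pos scaleR_scaleR left_inverse scaleR_one)
  \<comment> \<open>The completed square is the squared distance to \<open>xstar\<close> of
    \<open>x k - (1 / \<mu>) *\<^sub>R g\<close>, the very point averaged into
    \<open>z (k + 1)\<close>.\<close>
  have str: "\<mu> / 2 * (norm (X - (1 / \<mu>) *\<^sub>R g))\<^sup>2 \<le> - (f (x k) - fstar) + (norm g)\<^sup>2 / (2 * \<mu>)"
  proof -
    have "fstar \<ge> f (x k) - g \<bullet> X + \<mu> / 2 * (norm X)\<^sup>2"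
      using f(3)[of "x k" xstar]
      by (simp add: assms(14) g_def X_def norm_minus_commute inner_diff_right)
    moreover have "\<mu> / 2 * (norm (X - (1 / \<mu>) *\<^sub>R g))\<^sup>2
      = \<mu> / 2 * (norm X)\<^sup>2 - g \<bullet> X + (norm g)\<^sup>2 / (2 * \<mu>)"
      using \<open>0 < \<mu>\<close> unfolding norm_diff_sq
      by (simp add: power_mult_distrib inner_commute field_simps power2_eq_square)
    ultimately show ?thesis by simp
  qed
  \<comment> \<open>Dividing by \<open>1 - a\<close> gives the \<open>Z\<close> term the coefficient
    \<open>\<mu> / 2\<close> that it has in the goal.\<close>
  have z_step: "1 / (1 - a) * (\<mu> / 2) * (norm (z (k + 1) - xstar))\<^sup>2
      \<le> a / (1 - a) * (- (f (x k) - fstar) + (norm g)\<^sup>2 / (2 * \<mu>)) + \<mu> / 2 * (norm Z)\<^sup>2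
        - a * (\<mu> / 2 * (norm (x k - z k))\<^sup>2 - g \<bullet> (x k - z k) + (norm g)\<^sup>2 / (2 * \<mu>))"
  proof -
    have "z (k + 1) - xstar = a *\<^sub>R (X - (1 / \<mu>) *\<^sub>R g) + (1 - a) *\<^sub>R Z"
      unfolding zk X_def Z_def by (simp add: algebra_simps)
    moreover have "X - (1 / \<mu>) *\<^sub>R g - Z = (x k - z k) - (1 / \<mu>) *\<^sub>R g"
      by (simp add: X_def Z_def)
    ultimately have "(norm (z (k + 1) - xstar))\<^sup>2 = a * (norm (X - (1 / \<mu>) *\<^sub>R g))\<^sup>2
        + (1 - a) * (norm Z)\<^sup>2 - a * (1 - a) * (norm ((x k - z k) - (1 / \<mu>) *\<^sub>R g))\<^sup>2"
      by (simp only: norm_convex_comb_sq)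
    moreover have "1 / d * (\<mu> / 2) * (a * P + d * Q - a * d * R)
      = a / d * (\<mu> / 2 * P) + \<mu> / 2 * Q - a * (\<mu> / 2 * R)" if "d \<noteq> 0" for d P Q R
      using that by (simp add: field_simps)
    ultimately have "1 / (1 - a) * (\<mu> / 2) * (norm (z (k + 1) - xstar))\<^sup>2
      = a / (1 - a) * (\<mu> / 2 * (norm (X - (1 / \<mu>) *\<^sub>R g))\<^sup>2) + \<mu> / 2 * (norm Z)\<^sup>2
        - a * (\<mu> / 2 * (norm ((x k - z k) - (1 / \<mu>) *\<^sub>R g))\<^sup>2)"
      using a(2) by (metis less_irrefl)
    moreover have "\<mu> / 2 * (norm ((x k - z k) - (1 / \<mu>) *\<^sub>R g))\<^sup>2
      = \<mu> / 2 * (norm (x k - z k))\<^sup>2 - g \<bullet> (x k - z k) + (norm g)\<^sup>2 / (2 * \<mu>)"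
      using \<open>0 < \<mu>\<close> unfolding norm_diff_sq[of "x k - z k" "(1 / \<mu>) *\<^sub>R g"]
      by (simp add: power_mult_distrib inner_commute[of g] distrib_left right_diff_distrib)
         (simp add: field_simps power2_eq_square)
    moreover have "a / (1 - a) * (\<mu> / 2 * (norm (X - (1 / \<mu>) *\<^sub>R g))\<^sup>2)
        \<le> a / (1 - a) * (- (f (x k) - fstar) + (norm g)\<^sup>2 / (2 * \<mu>))"
      using a by (intro mult_left_mono[OF str]) auto
    ultimately show ?thesis
      by (simp only: add_right_mono diff_right_mono)
  qed
  \<comment> \<open>Here \<open>a / (1 - a) - a = a\<^sup>2 / (1 - a)\<close>, and \<open>r2\<close>
    removes \<open>\<mu>\<close> from \<open>a\<^sup>2 / \<mu>\<close>.\<close>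
  have g_coeff: "a / (1 - a) * ((norm g)\<^sup>2 / (2 * \<mu>)) - a * ((norm g)\<^sup>2 / (2 * \<mu>))
      = \<nu> * s / 2 * (\<nu> / (1 - a)) * (norm g)\<^sup>2"
  proof -
    have "a / (1 - a) * ((norm g)\<^sup>2 / (2 * \<mu>)) - a * ((norm g)\<^sup>2 / (2 * \<mu>))
      = a\<^sup>2 / (2 * \<mu> * (1 - a)) * (norm g)\<^sup>2"
      using a \<open>0 < \<mu>\<close> by (simp add: field_simps power2_eq_square)
    also have "a\<^sup>2 = \<nu>\<^sup>2 * (\<mu> * s)"
      by (simp add: a_def power_mult_distrib r2)
    finally show ?thesis
      using \<open>0 < \<mu>\<close> by (simp add: power2_eq_square)
  qed
  \<comment> \<open>\<open>F\<close> is \<open>f (x k) - fstar\<close> minus the bracket on the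
    right of the goal, so \<open>fstar\<close> drops out.\<close>
  define F where "F = f (x k) - f (x j) + b / 2 * (norm h)\<^sup>2"
  \<comment> \<open>Cocoercivity is weakened from \<open>1 / L\<close> to \<open>b\<close>. The
    cross term \<open>b * (g \<bullet> h)\<close> of the expanded square then merges with
    \<open>x j - x k\<close> into \<open>p\<close>.\<close>
  have coco: "F + b / 2 * (norm g)\<^sup>2 + g \<bullet> p \<le> 0"
  proof -
    have "f (x j) \<ge> f (x k) + g \<bullet> (x j - x k) + 1 / (2 * L) * (norm (g - h))\<^sup>2"
      using cocoercivity[OF L f(1,2) cvx] by (simp add: g_def h_def)
    moreover have "b / 2 * (norm (g - h))\<^sup>2 \<le> 1 / (2 * L) * (norm (g - h))\<^sup>2"
      using b by (intro mult_right_mono) auto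
    moreover have "g \<bullet> p = g \<bullet> (x j - x k) - b * (g \<bullet> h)"
      by (simp add: p_def yk inner_diff_right)
    ultimately show ?thesis
      unfolding F_def norm_diff_sq by (simp add: algebra_simps)
  qed
  \<comment> \<open>The factor \<open>b\<close> stays on the left because \<open>b\<close> may be
    zero.\<close>
  have young: "b * F \<le> 1 / 2 * (norm p)\<^sup>2"
  proof -
    have "0 \<le> (norm (p + b *\<^sub>R g))\<^sup>2" by simp
    also have "\<dots> = (norm p)\<^sup>2 + 2 * b * (g \<bullet> p) + b\<^sup>2 * (norm g)\<^sup>2"
      unfolding power2_norm_eq_inner
      by (simp add: inner_simps inner_commute[of p g] power2_eq_square distrib_left)
    finally show ?thesis
      using mult_left_mono[OF coco b(1)] by (simp add: algebra_simps power2_eq_square)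
  qed
  define C where "C = \<zeta> * \<nu> / \<tau>\<^sup>2 * (\<tau> + \<zeta> * \<eta> * r)"
  have C: "C = \<zeta> * \<nu> / \<tau> + \<zeta>\<^sup>2 * \<nu> / \<tau>\<^sup>2 * (\<eta> * r)"
    using \<open>\<tau> > 0\<close> by (simp add: C_def field_simps power2_eq_square)
  have rest: "C * F + \<nu> * s / 2 * (\<zeta> * \<eta> / \<tau>) * (norm g)\<^sup>2
      + a * (g \<bullet> (x k - z k)) - a * (\<mu> / 2 * (norm (x k - z k))\<^sup>2) \<le> 0"
  proof -
    have "\<zeta> * \<nu> / \<tau> * (F + b / 2 * (norm g)\<^sup>2 + g \<bullet> p) \<le> 0"
      using coco assms by (intro mult_nonneg_nonpos) auto
    moreover have "\<zeta>\<^sup>2 * \<nu> / \<tau>\<^sup>2 * (\<eta> * r) * F \<le> a * (\<mu> / 2 * (norm (x k - z k))\<^sup>2)"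
    proof -
      \<comment> \<open>Trading \<open>\<eta>\<close> for \<open>b\<close> produces the product
        \<open>b * F\<close> that \<open>young\<close> bounds.\<close>
      have "\<eta> * r = \<mu> / r * b"
        using r r2 by (simp add: b_def field_simps power2_eq_square)
      then have "\<zeta>\<^sup>2 * \<nu> / \<tau>\<^sup>2 * (\<eta> * r) * F = \<zeta>\<^sup>2 * \<nu> / \<tau>\<^sup>2 * (\<mu> / r) * (b * F)"
        by simp
      also have "\<dots> \<le> \<zeta>\<^sup>2 * \<nu> / \<tau>\<^sup>2 * (\<mu> / r) * (1 / 2 * (norm p)\<^sup>2)"
        using young assms r by (intro mult_left_mono) auto
      \<comment> \<open>The weights agree exactly: by \<open>xz'\<close>, the negative square from
        \<open>z_step\<close> is entirely consumed.\<close>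
      also have "\<dots> = a * (\<mu> / 2 * (norm (x k - z k))\<^sup>2)"
        unfolding xz' using r \<open>\<tau> > 0\<close>
        by (simp add: a_def power_mult_distrib power_divide) (simp add: field_simps power2_eq_square)
      finally show ?thesis .
    qed
    moreover have "a * (g \<bullet> (x k - z k)) = \<zeta> * \<nu> / \<tau> * (g \<bullet> p)"
      unfolding xz' using r by (simp add: a_def)
    moreover have "C * F = \<zeta> * \<nu> / \<tau> * F + \<zeta>\<^sup>2 * \<nu> / \<tau>\<^sup>2 * (\<eta> * r) * F"
      by (simp only: C distrib_right)
    moreover have "\<nu> * s / 2 * (\<zeta> * \<eta> / \<tau>) * (norm g)\<^sup>2 = \<zeta> * \<nu> / \<tau> * (b / 2 * (norm g)\<^sup>2)"
      by (simp add: b_def mult_ac)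
    ultimately show ?thesis
      unfolding distrib_left by linarith
  qed
  have "(C + a / (1 - a)) * (f (x k) - fstar)
          - \<nu> * s / 2 * (\<nu> / (1 - a) - \<zeta> * \<eta> / \<tau>) * (norm g)\<^sup>2
          + 1 / (1 - a) * (\<mu> / 2) * (norm (z (k + 1) - xstar))\<^sup>2
        \<le> C * (f (x j) - fstar - b / 2 * (norm h)\<^sup>2) + \<mu> / 2 * (norm Z)\<^sup>2"
    proof -
    \<comment> \<open>Once everything is expanded into common products, the goal is the sum of
      \<open>z_step\<close>, \<open>g_coeff\<close> and \<open>rest\<close>; the terms in
      \<open>a / (1 - a)\<close> times \<open>f (x k) - fstar\<close> cancel.\<close>
    have split: "a / (1 - a) * (- (f (x k) - fstar) + (norm g)\<^sup>2 / (2 * \<mu>))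
      = - (a / (1 - a)) * (f (x k) - fstar) + a / (1 - a) * ((norm g)\<^sup>2 / (2 * \<mu>))"
      "a * (\<mu> / 2 * (norm (x k - z k))\<^sup>2 - g \<bullet> (x k - z k) + (norm g)\<^sup>2 / (2 * \<mu>))
      = a * (\<mu> / 2 * (norm (x k - z k))\<^sup>2) - a * (g \<bullet> (x k - z k)) + a * ((norm g)\<^sup>2 / (2 * \<mu>))"
      "(C + a / (1 - a)) * (f (x k) - fstar)
      = C * (f (x k) - fstar) + a / (1 - a) * (f (x k) - fstar)"
      "\<nu> * s / 2 * (\<nu> / (1 - a) - \<zeta> * \<eta> / \<tau>) * (norm g)\<^sup>2
      = \<nu> * s / 2 * (\<nu> / (1 - a)) * (norm g)\<^sup>2 - \<nu> * s / 2 * (\<zeta> * \<eta> / \<tau>) * (norm g)\<^sup>2"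
      by (simp_all only: distrib_left distrib_right right_diff_distrib left_diff_distrib
          mult_minus_left mult_minus_right)
    have CF: "C * (f (x j) - fstar - b / 2 * (norm h)\<^sup>2) = C * (f (x k) - fstar) - C * F"
      unfolding F_def by (simp only: right_diff_distrib[symmetric]) simp
    show ?thesis
      using z_step g_coeff rest unfolding split CF by linarith
  qed
  then show ?thesis
    by (simp add: C_def a_def b_def r_def g_def h_def Z_def k)
qed

end
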